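(* Let $\mathbf{s}_1,\dots,\mathbf{s}_M\in\mathbb{R}^n$ ($M\ge 2$, $n\ge1$) be any constellation of distinct points with any bit mapping (this includes coding under maximum likelihood decoding). Then the bit error rate $\mathrm{BER}$ of the maximum likelihood detector in the AWGN channel is a convex function of the noise power $\sigma_0^2>0$ in the small noise/high SNR mode $$\left(n+2+\sqrt{2(n+2)}\right)\sigma_0^2\le d_{\min}^2,$$ where $d_{\min}$ is the minimum distance from a constellation point to the boundary of its decision region, minimized over the constellation.
   Context: Channel: $\mathbf{r}=\mathbf{s}+\boldsymbol{\xi}$, where $\mathbf{s}\in\{\mathbf{s}_1,\dots,\mathbf{s}_M\}\subset\mathbb{R}^n$ is the transmitted point and $\boldsymbol{\xi}\sim\mathcal{N}(\mathbf{0},\sigma_0^2\mathbf{I})$ has density $p_\xi(\mathbf{x})=(2\pi\sigma_0^2)^{-n/2}e^{-|\mathbf{x}|^2/(2\sigma_0^2)}$, with $|\cdot|$ the Euclidean norm. The constellation is normalized by $\frac1M\sum_{k=1}^M|\mathbf{s}_k|^2=1$; the constellation, bit mapping and prior probabilities $\Pr\{\mathbf{s}=\mathbf{s}_i\}$ are fixed while $\sigma_0^2$ varies. (Codewords of a code under maximum likelihood decoding are regarded as points of a constellation.) The maximum likelihood (minimum distance) detector outputs $\hat{\mathbf{s}}=\arg\min_{\mathbf{s}_k}|\mathbf{r}-\mathbf{s}_k|$. The decision region of $\mathbf{s}_k$ is its closed Voronoi cell $V_k=\{\mathbf{r}\in\mathbb{R}^n: |\mathbf{r}-\mathbf{s}_k|\le|\mathbf{r}-\mathbf{s}_l|\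 \forall l\}$. The pairwise error probability is $\Pr\{\mathbf{s}_i\to\mathbf{s}_j\}=\Pr[\hat{\mathbf{s}}=\mathbf{s}_j\mid\mathbf{s}=\mathbf{s}_i]=\int_{V_j-\mathbf{s}_i}p_\xi(\mathbf{x})\,d\mathbf{x}$ for $i\neq j$. A bit mapping assigns to each $\mathbf{s}_k$ a binary sequence (all of a common length); $h_{ij}$ is the Hamming distance between the sequences representing $\mathbf{s}_i$ and $\mathbf{s}_j$. The bit error rate is $$\mathrm{BER}=\sum_{i=1}^M\sum_{j\ne i}\frac{h_{ij}}{\log_2 M}\Pr\{\mathbf{s}=\mathbf{s}_i\}\Pr\{\mathbf{s}_i\to\mathbf{s}_j\}.$$ Notation: $d_{\min,i}=\min_{k\ne i}\frac12|\mathbf{s}_k-\mathbf{s}_i|$ is the minimum distance from $\mathbf{s}_i$ to the boundary of $V_i$, and $d_{\min}=\min_i d_{\min,i}$. *)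

theory Defs
  imports "HOL-Analysis.Analysis"
begin

text \<open>
  A constellation of \<open>M\<close> points is a function \<open>s\<close> on the index set \<open>{1..M}\<close>; values of \<open>s\<close>
  outside this set are never used. The real parameter \<open>v\<close> is the noise power per dimension
  (the variance, not the standard deviation).
\<close>

definition noise_density :: "real \<Rightarrow> real ^ 'n \<Rightarrow> real" where
  "noise_density v x =
     (2 * pi * v) powr (- real CARD('n) / 2) * exp (- (norm x)\<^sup>2 / (2 * v))"

definition voronoi_cell :: "nat \<Rightarrow> (nat \<Rightarrow> real ^ 'n) \<Rightarrow> nat \<Rightarrow> (real ^ 'n) set" where
  "voronoi_cell M s k = {r. \<forall>l\<in>{1..M}. norm (r - s k) \<le> norm (r - s l)}"

definition pairwise_error_prob ::
  "nat \<Rightarrow> (nat \<Rightarrow> real ^ 'n) \<Rightarrow> real \<Rightarrow> nat \<Rightarrow> nat \<Rightarrow> real" where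
  "pairwise_error_prob M s v i j =
     (LINT x : (\<lambda>r. r - s i) ` voronoi_cell M s j | lborel. noise_density v x)"

text \<open>Only meaningful for lists of equal length.\<close>

definition hamming_distance :: "bool list \<Rightarrow> bool list \<Rightarrow> nat" where
  "hamming_distance xs ys = card {k. k < length xs \<and> xs ! k \<noteq> ys ! k}"

definition bit_error_rate ::
  "nat \<Rightarrow> (nat \<Rightarrow> real ^ 'n) \<Rightarrow> (nat \<Rightarrow> bool list) \<Rightarrow> (nat \<Rightarrow> real) \<Rightarrow> real \<Rightarrow> real" where
  "bit_error_rate M s b p v =
     (\<Sum>i = 1..M. \<Sum>j \<in> {1..M} - {i}.
        real (hamming_distance (b i) (b j)) / log 2 (real M) * p i
          * pairwise_error_prob M s v i j)"

definition min_dist_at :: "nat \<Rightarrow> (nat \<Rightarrow> real ^ 'n) \<Rightarrow> nat \<Rightarrow> real" where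
  "min_dist_at M s i = Min ((\<lambda>k. norm (s k - s i) / 2) ` ({1..M} - {i}))"

definition min_dist :: "nat \<Rightarrow> (nat \<Rightarrow> real ^ 'n) \<Rightarrow> real" where
  "min_dist M s = Min (min_dist_at M s ` {1..M})"

lemma min_dist_at_eq_infdist_frontier:
  fixes s :: "nat \<Rightarrow> real ^ 'n"
  assumes M: "2 \<le> M" and inj: "inj_on s {1..M}" and i: "i \<in> {1..M}"
  shows "min_dist_at M s i = infdist (s i) (frontier (voronoi_cell M s i))"
proof -
  define d where "d = min_dist_at M s i"
  let ?V = "voronoi_cell M s i"
  let ?F = "(\<lambda>k. norm (s k - s i) / 2) ` ({1..M} - {i})"
  have ne: "{1..M} - {i} \<noteq> {}"
  proof
    assume "{1..M} - {i} = {}"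
    then have "{1..M} \<subseteq> {i}" by blast
    then have "card {1..M} \<le> card {i}" by (intro card_mono) auto
    then show False using M by simp
  qed
  have "d \<in> ?F" unfolding d_def min_dist_at_def by (rule Min_in) (use ne in auto)
  then obtain k where k: "k \<in> {1..M}" "k \<noteq> i" "d = norm (s k - s i) / 2" by blast
  have le: "2 * d \<le> norm (s l - s i)" if "l \<in> {1..M}" "l \<noteq> i" for l
  proof -
    have "d \<le> norm (s l - s i) / 2"
      unfolding d_def min_dist_at_def by (rule Min_le) (use that in auto)
    then show ?thesis by simp
  qed
  have "s k \<noteq> s i" using k(1,2) inj i by (meson inj_on_def)
  then have "0 < norm (s k - s i)" by simp
  then have dpos: "0 < d" using k(3) by linarith
  have inV: "x \<in> ?V" if x: "norm (x - s i) \<le> d" for x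
    unfolding voronoi_cell_def
  proof (intro CollectI ballI)
    fix l assume l: "l \<in> {1..M}"
    show "norm (x - s i) \<le> norm (x - s l)"
    proof (cases "l = i")
      case False
      have "norm (s l - s i) \<le> norm (x - s i) + norm (x - s l)"
        using norm_triangle_ineq4[of "x - s i" "x - s l"] by simp
      with le[OF l False] x show ?thesis by linarith
    qed simp
  qed
  have "ball (s i) d \<subseteq> ?V"
    using inV by (auto simp: dist_norm norm_minus_commute)
  then have int: "ball (s i) d \<subseteq> interior ?V" by (simp add: interior_maximal)
  have lower: "d \<le> dist (s i) y" if "y \<in> frontier ?V" for y
  proof (rule ccontr)
    assume "\<not> d \<le> dist (s i) y"
    then have "y \<in> interior ?V" using int by auto
    with that show False by (simp add: frontier_def)
  qed
  define m where "m = (1/2) *\<^sub>R (s i + s k)"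
  have mi: "m - s i = (1/2) *\<^sub>R (s k - s i)"
    unfolding m_def by (simp add: algebra_simps vec_eq_iff)
  have nm: "norm (m - s i) = d"
    unfolding mi using k(3) by simp
  then have dm: "dist (s i) m = d"
    by (metis dist_commute dist_norm)
  have mV: "m \<in> ?V" using inV nm by simp
  have "m \<notin> interior ?V"
  proof
    assume "m \<in> interior ?V"
    then obtain e where e: "e > 0" "ball m e \<subseteq> ?V" by (meson mem_interior)
    define t where "t = min (1/2) (e / (4 * d))"
    have t: "0 < t" "t \<le> 1/2" "t \<le> e / (4*d)" using e dpos by (auto simp: t_def)
    define y where "y = m + t *\<^sub>R (s k - s i)"
    have "norm (y - m) = t * (2 * d)" using t k(3) by (simp add: y_def)
    also have "\<dots> \<le> e / (4*d) * (2*d)" using t dpos by (intro mult_right_mono) auto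
    also have "\<dots> < e" using dpos e by (simp add: field_simps)
    finally have "y \<in> ?V" using e by (auto simp: dist_norm norm_minus_commute)
    then have c: "norm (y - s i) \<le> norm (y - s k)" using k by (auto simp: voronoi_cell_def)
    have "y - s i = (1/2 + t) *\<^sub>R (s k - s i)"
      using mi unfolding y_def by (simp add: algebra_simps)
    then have a: "norm (y - s i) = (1/2 + t) * (2*d)" using t k(3) by simp
    have "y - s k = (t - 1/2) *\<^sub>R (s k - s i)"
      unfolding y_def m_def by (simp add: algebra_simps vec_eq_iff)
    then have b: "norm (y - s k) = (1/2 - t) * (2*d)" using t k(3) by simp
    from a b c have "t * d \<le> 0" by (simp add: algebra_simps)
    with t dpos show False by (simp add: mult_le_0_iff)
  qed
  then have mF: "m \<in> frontier ?V" using mV closure_subset by (auto simp: frontier_def)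
  have "infdist (s i) (frontier ?V) \<le> d" using infdist_le[OF mF, of "s i"] dm by simp
  moreover have "d \<le> infdist (s i) (frontier ?V)"
  proof -
    have nonempty: "frontier ?V \<noteq> {}" using mF by blast
    show ?thesis unfolding infdist_notempty[OF nonempty]
      by (rule cINF_greatest[OF nonempty lower])
  qed
  ultimately show ?thesis by (simp add: d_def)
qed

end

(*
  For fixed x the Gaussian density, as a function of the noise power v, has second derivative
  of the sign of |x|^4 - 2(n+2)|x|^2 v + n(n+2)v^2, which is nonnegative as soon as |x|^2 is at
  least the larger root (n + 2 + sqrt (2(n+2))) v. The error regions only contain noise vectors
  of norm at least d_min, so every pairwise error probability is an integral of convex functions.
*)

theory Submission
  imports Defs "HOL-Probability.Distributions"
begin

lemma convex_on_sum_fun: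
  fixes f :: "'i \<Rightarrow> 'a::real_vector \<Rightarrow> real"
  assumes "convex S" "\<And>i. i \<in> I \<Longrightarrow> convex_on S (f i)"
  shows "convex_on S (\<lambda>x. \<Sum>i\<in>I. f i x)"
  using assms(2)
proof (induction I rule: infinite_finite_induct)
  case (insert i I)
  then show ?case by (simp add: convex_on_add)
\<comment> \<open>For infinite \<open>I\<close> the sum defaults to 0, so this case and the empty
  one are constant functions.\<close>
qed (simp_all add: convex_on_const assms(1))

text \<open>The convexity inequality holds pointwise on \<open>A\<close> and survives integration by
  monotonicity and linearity. Since \<open>S\<close> is convex, the integrand at the intermediate
  parameter is integrable too.\<close>

lemma convex_on_set_lebesgue_integral:
  fixes f :: "'a::real_vector \<Rightarrow> 'b \<Rightarrow> real"
  assumes S: "convex S"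
    and int: "\<And>v. v \<in> S \<Longrightarrow> set_integrable M A (f v)"
    and conv: "\<And>x. x \<in> A \<Longrightarrow> convex_on S (\<lambda>v. f v x)"
  shows "convex_on S (\<lambda>v. LINT x:A|M. f v x)"
proof (rule convex_onI[OF _ S])
  fix t u v assume t: "0 < t" "t < (1::real)" and uv: "u \<in> S" "v \<in> S"
  have w: "(1 - t) *\<^sub>R u + t *\<^sub>R v \<in> S"
    using convexD_alt[OF S] uv t by simp
  have iu: "set_integrable M A (\<lambda>x. (1 - t) * f u x)"
    and iv: "set_integrable M A (\<lambda>x. t * f v x)"
    using int uv by auto
  have "(LINT x:A|M. f ((1 - t) *\<^sub>R u + t *\<^sub>R v) x)
      \<le> (LINT x:A|M. (1 - t) * f u x + t * f v x)"
    by (intro set_integral_mono int w set_integral_add iu iv)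
      (use convex_onD[OF conv] t uv in simp)
  then show "(LINT x:A|M. f ((1 - t) *\<^sub>R u + t *\<^sub>R v) x)
      \<le> (1 - t) * (LINT x:A|M. f u x) + t * (LINT x:A|M. f v x)"
    using set_integral_add(2)[OF iu iv] by simp
qed

text \<open>In an orthonormal basis the density factors into one-dimensional normal densities with
  standard deviation \<open>sqrt v\<close>, each integrable on the line.\<close>

lemma integrable_noise_density:
  fixes v :: real
  assumes v: "0 < v"
  shows "integrable lborel (noise_density v :: real ^ 'n \<Rightarrow> real)"
proof -
  interpret product_sigma_finite "\<lambda>_::real ^ 'n. lborel :: real measure" ..
  \<comment> \<open>This map assembles a vector from its coordinates; \<open>lborel\<close> is the
    image of the product measure under it.\<close>
  have meas: "(\<lambda>f. \<Sum>b\<in>Basis. f b *\<^sub>R b)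
      \<in> (\<Pi>\<^sub>M b\<in>(Basis :: (real ^ 'n) set). lborel) \<rightarrow>\<^sub>M (borel :: (real ^ 'n) measure)"
    by measurable
  have dens: "(\<lambda>x :: real ^ 'n. \<Prod>b\<in>Basis. normal_density 0 (sqrt v) (x \<bullet> b)) \<in> borel_measurable borel"
    by measurable
  have "integrable (\<Pi>\<^sub>M b\<in>(Basis :: (real ^ 'n) set). lborel)
      (\<lambda>f. \<Prod>b\<in>Basis. normal_density 0 (sqrt v) (f b))"
    by (intro product_integrable_prod) (use v in auto)
  then have "integrable lborel (\<lambda>x :: real ^ 'n. \<Prod>b\<in>Basis. normal_density 0 (sqrt v) (x \<bullet> b))"
    by (subst lborel_eq) (simp add: integrable_distr_eq[OF meas dens])
  moreover have "(\<Prod>b\<in>Basis. normal_density 0 (sqrt v) (x \<bullet> b)) = noise_density v x"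
    for x :: "real ^ 'n"
  proof -
    have "(norm x)\<^sup>2 = (\<Sum>b\<in>Basis. (x \<bullet> b)\<^sup>2)"
      unfolding power2_norm_eq_inner by (subst euclidean_inner) (simp add: power2_eq_square)
    then have "exp (- (norm x)\<^sup>2 / (2 * v)) = (\<Prod>b\<in>Basis. exp (- (x \<bullet> b)\<^sup>2 / (2 * v)))"
      by (simp add: exp_sum[symmetric] sum_negf sum_divide_distrib)
    moreover have "(2 * pi * v) powr (- real CARD('n) / 2) = (1 / sqrt (2 * pi * v)) ^ CARD('n)"
    proof -
      have "(1 / sqrt (2 * pi * v)) ^ CARD('n) = ((2 * pi * v) powr (- 1 / 2)) ^ CARD('n)"
        using v by (simp add: powr_minus_divide powr_half_sqrt)
      also have "\<dots> = (2 * pi * v) powr (- 1 / 2 * real CARD('n))"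
        using v by (subst powr_power) auto
      finally show ?thesis by simp
    qed
    ultimately show ?thesis
      using v by (simp add: noise_density_def normal_density_def prod_dividef power_one_over)
  qed
  ultimately show ?thesis by simp
qed

lemma convex_on_noise_density:
  fixes x :: "real ^ 'n"
  assumes S: "convex S"
    and low: "\<And>v. v \<in> S \<Longrightarrow> 0 < v \<and>
      (real CARD('n) + 2 + sqrt (2 * (real CARD('n) + 2))) * v \<le> (norm x)\<^sup>2"
  shows "convex_on S (\<lambda>v. noise_density v x)"
proof -
  define n where "n = real CARD('n)"
  define a where "a = (norm x)\<^sup>2"
  \<comment> \<open>\<open>k\<close> is the logarithmic derivative of the density in
    \<open>v\<close>, and \<open>k'\<close> is the derivative of \<open>k\<close>. Hence f' = f k
    and f'' = f (k^2 + k'), and as f is nonnegative it suffices that k^2 + k' is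
    nonnegative.\<close>
  define k where "k v = a / (2 * v\<^sup>2) - n / (2 * v)" for v :: real
  define k' where "k' v = - a / v ^ 3 + n / (2 * v\<^sup>2)" for v :: real
  define f where "f v = noise_density v x" for v
  have f: "f v = (2 * pi * v) powr (- n / 2) * exp (- a / (2 * v))" for v
    by (simp add: f_def noise_density_def n_def a_def)
  have Df: "(f has_real_derivative f v * k v) (at v)" if v: "0 < v" for v
  proof -
    \<comment> \<open>The summand with \<open>0 * ln\<close> is the contribution of the exponent,
      which is constant in \<open>v\<close>.\<close>
    have "((\<lambda>v. (2 * pi * v) powr (- n / 2)) has_real_derivative
        (2 * pi * v) powr (- n / 2) * (0 * ln (2 * pi * v) + 2 * pi * (- n / 2) / (2 * pi * v))) (at v)"
      by (rule DERIV_powr) (use v in \<open>auto intro!: derivative_eq_intros\<close>)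
    moreover have "((\<lambda>v. - a / (2 * v)) has_real_derivative a / (2 * v\<^sup>2)) (at v)"
      using v by (auto intro!: derivative_eq_intros simp: power2_eq_square)
    ultimately have "(f has_real_derivative
        (2 * pi * v) powr (- n / 2) * (0 * ln (2 * pi * v) + 2 * pi * (- n / 2) / (2 * pi * v))
          * exp (- a / (2 * v))
        + exp (- a / (2 * v)) * (a / (2 * v\<^sup>2)) * (2 * pi * v) powr (- n / 2)) (at v)"
      unfolding f[abs_def] by (intro DERIV_mult DERIV_fun_exp)
    moreover have "2 * pi * (- n / 2) / (2 * pi * v) = - (n / (2 * v))"
      using v by simp
    ultimately show ?thesis
      by (simp add: f k_def algebra_simps)
  qed
  have Dk: "(k has_real_derivative k' v) (at v)" if v: "0 < v" for v
  proof -
    have "((\<lambda>v. a / (2 * v\<^sup>2)) has_real_derivative - a / v ^ 3) (at v)"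
      by (rule derivative_eq_intros refl | use v in \<open>simp add: power2_eq_square power3_eq_cube\<close>)+
    moreover have "((\<lambda>v. n / (2 * v)) has_real_derivative - (n / (2 * v\<^sup>2))) (at v)"
      by (rule derivative_eq_intros refl | use v in \<open>simp add: power2_eq_square\<close>)+
    ultimately have "(k has_real_derivative - a / v ^ 3 - - (n / (2 * v\<^sup>2))) (at v)"
      unfolding k_def[abs_def] by (rule DERIV_diff)
    then show ?thesis by (simp add: k'_def)
  qed
  have "convex_on S f"
  proof (rule f''_ge0_imp_convex[OF S])
    fix v assume v: "v \<in> S"
    then have pos: "0 < v" using low by blast
    show "(f has_real_derivative f v * k v) (at v)" by (rule Df[OF pos])
    show "((\<lambda>v. f v * k v) has_real_derivative f v * k v * k v + f v * k' v) (at v)"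
      using DERIV_mult[OF Df[OF pos] Dk[OF pos]] by (simp add: algebra_simps)
    \<comment> \<open>The quadratic a^2 - 2(n+2)av + n(n+2)v^2 in \<open>a\<close> has the roots (n
      + 2 - r)v and (n + 2 + r)v. The hypothesis puts \<open>a\<close> at or beyond the larger root,
      so both linear factors are nonnegative.\<close>
    define r where "r = sqrt (2 * (n + 2))"
    have r: "0 \<le> r" "r\<^sup>2 = 2 * (n + 2)" by (auto simp: r_def n_def)
    have "(n + 2 + r) * v \<le> a" using low[OF v] by (simp add: r_def n_def a_def)
    then have "0 \<le> a - (n + 2 + r) * v" "0 \<le> a - (n + 2 - r) * v"
      using mult_nonneg_nonneg[OF r(1), of v] pos by (simp_all add: algebra_simps)
    then have "0 \<le> (a - (n + 2 + r) * v) * (a - (n + 2 - r) * v)" by simp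
    also have "\<dots> = a\<^sup>2 - 2 * (n + 2) * a * v + ((n + 2)\<^sup>2 - r\<^sup>2) * v\<^sup>2"
      by algebra
    \<comment> \<open>This regrouping isolates \<open>a - n * v\<close> and
      \<open>n * v - 2 * a\<close>, which are \<open>k v\<close> and \<open>k' v\<close> cleared of
      denominators.\<close>
    also have "\<dots> = (a - n * v)\<^sup>2 + 2 * v * (n * v - 2 * a)"
      unfolding r(2) by (simp add: power2_eq_square algebra_simps)
    also have "\<dots> = (2 * v\<^sup>2 * k v)\<^sup>2 + 2 * v * (2 * v ^ 3 * k' v)"
    proof -
      have "2 * v\<^sup>2 * k v = a - n * v"
        using pos by (simp add: k_def right_diff_distrib power2_eq_square)
      moreover have "2 * v ^ 3 * k' v = n * v - 2 * a"
        using pos by (simp add: k'_def right_diff_distrib distrib_left power2_eq_square power3_eq_cube)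
      ultimately show ?thesis by simp
    qed
    also have "\<dots> = 4 * v ^ 4 * (k v * k v + k' v)"
      by algebra
    finally have "0 \<le> k v * k v + k' v" using pos by (simp add: zero_le_mult_iff)
    then have "0 \<le> f v * (k v * k v + k' v)" by (simp add: f)
    then show "0 \<le> f v * k v * k v + f v * k' v" by (simp add: algebra_simps)
  qed
  then show ?thesis by (simp add: f_def[abs_def])
qed

lemma min_dist_nonneg:
  assumes "2 \<le> M"
  shows "0 \<le> min_dist M s"
proof -
  have "0 \<le> min_dist_at M s i" if "i \<in> {1..M}" for i
  proof -
    \<comment> \<open>A second index exists because \<open>M\<close> is at least 2;
      \<open>Min\<close> is informative only on a nonempty set.\<close>
    have "(if i = 1 then 2 else 1) \<in> {1..M} - {i}" using assms by auto
    then have "{1..M} - {i} \<noteq> {}" by blast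
    then show ?thesis unfolding min_dist_at_def by (subst Min_ge_iff) auto
  qed
  then show ?thesis unfolding min_dist_def using assms by (subst Min_ge_iff) auto
qed

lemma min_dist_le:
  assumes "i \<in> {1..M}" "j \<in> {1..M}" "i \<noteq> j"
  shows "min_dist M s \<le> norm (s j - s i) / 2"
proof -
  have "min_dist M s \<le> min_dist_at M s i"
    unfolding min_dist_def using assms by (intro Min_le) auto
  also have "\<dots> \<le> norm (s j - s i) / 2"
    unfolding min_dist_at_def using assms by (intro Min_le) auto
  finally show ?thesis .
qed

text \<open>A received point in the cell of \<open>s j\<close> is at least as close to
  \<open>s j\<close> as to \<open>s i\<close>, so by the triangle inequality the noise
  \<open>r - s i\<close> has at least half the length of \<open>s j - s i\<close>.\<close>

lemma min_dist_le_norm_error_region: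
  assumes "i \<in> {1..M}" "j \<in> {1..M}" "i \<noteq> j"
    and "x \<in> (\<lambda>r. r - s i) ` voronoi_cell M s j"
  shows "min_dist M s \<le> norm x"
proof -
  obtain r where r: "x = r - s i" "norm (r - s j) \<le> norm (r - s i)"
    using assms by (auto simp: voronoi_cell_def)
  have "norm (s j - s i) \<le> norm (r - s i) + norm (r - s j)"
    using norm_triangle_ineq4[of "r - s i" "r - s j"] by simp
  with r min_dist_le[OF assms(1-3), of s] show ?thesis by simp
qed

text \<open>Closedness makes the translated cells Borel, as integration over them requires.\<close>

lemma closed_voronoi_cell: "closed (voronoi_cell M s k)"
proof -
  have "voronoi_cell M s k = (\<Inter>l\<in>{1..M}. {r. norm (r - s k) \<le> norm (r - s l)})"
    by (auto simp: voronoi_cell_def)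
  then show ?thesis by (auto intro!: closed_INT closed_Collect_le continuous_intros)
qed

lemma convex_on_pairwise_error_prob:
  fixes s :: "nat \<Rightarrow> real ^ 'n"
  assumes ij: "2 \<le> M" "i \<in> {1..M}" "j \<in> {1..M}" "i \<noteq> j"
    and S: "convex S"
    and low: "\<And>v. v \<in> S \<Longrightarrow> 0 < v \<and>
      (real CARD('n) + 2 + sqrt (2 * (real CARD('n) + 2))) * v \<le> (min_dist M s)\<^sup>2"
  shows "convex_on S (\<lambda>v. pairwise_error_prob M s v i j)"
  unfolding pairwise_error_prob_def
proof (rule convex_on_set_lebesgue_integral[OF S])
  let ?A = "(\<lambda>r. r - s i) ` voronoi_cell M s j"
  show "set_integrable lborel ?A (noise_density v)" if "v \<in> S" for v
  proof -
    have "?A \<in> sets lborel"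
      using closed_translation_subtract[OF closed_voronoi_cell, of "s i" M s j] by simp
    then show ?thesis
      unfolding set_integrable_def
      using low[OF that] by (intro integrable_mult_indicator integrable_noise_density) auto
  qed
  show "convex_on S (\<lambda>v. noise_density v x)" if "x \<in> ?A" for x
  proof (rule convex_on_noise_density[OF S])
    \<comment> \<open>This carries the noise threshold from the constellation over to each single
      noise vector \<open>x\<close>; nonnegativity of \<open>min_dist M s\<close> allows the
      squaring.\<close>
    have "(min_dist M s)\<^sup>2 \<le> (norm x)\<^sup>2"
      using min_dist_le_norm_error_region[OF ij(2-4) that] min_dist_nonneg[OF ij(1)]
      by (rule power_mono)
    then show "0 < v \<and> (real CARD('n) + 2 + sqrt (2 * (real CARD('n) + 2))) * v \<le> (norm x)\<^sup>2"
      if "v \<in> S" for v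
      using low[OF that] by linarith
  qed
qed

theorem corollary5p1:
  fixes s :: "nat \<Rightarrow> real ^ 'n"
    and M L :: nat
    and b :: "nat \<Rightarrow> bool list"
    and p :: "nat \<Rightarrow> real"
  assumes "2 \<le> M"
    and distinct_points: "inj_on s {1..M}"
    and normalized: "(1 / real M) * (\<Sum>k = 1..M. (norm (s k))\<^sup>2) = 1"
    and common_length: "\<forall>k\<in>{1..M}. length (b k) = L"
    and prior_nonneg: "\<forall>k\<in>{1..M}. 0 \<le> p k"
    and prior_sum: "(\<Sum>k = 1..M. p k) = 1"
  shows "convex_on
           {v. 0 < v \<and>
               (real CARD('n) + 2 + sqrt (2 * (real CARD('n) + 2))) * v \<le> (min_dist M s)\<^sup>2}
           (bit_error_rate M s b p)"
proof -
  let ?c = "real CARD('n) + 2 + sqrt (2 * (real CARD('n) + 2))"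
  let ?S = "{v. 0 < v \<and> ?c * v \<le> (min_dist M s)\<^sup>2}"
  have "0 < ?c" by (simp add: add_pos_nonneg)
  \<comment> \<open>Dividing by the positive constant shows that the small noise regime is an
    interval, hence convex.\<close>
  then have "?S = {0<..(min_dist M s)\<^sup>2 / ?c}"
    by (auto simp: pos_le_divide_eq mult.commute)
  then have S: "convex ?S" by simp
  show ?thesis
    unfolding bit_error_rate_def
  \<comment> \<open>The weights do not depend on the noise power and are nonnegative, since
    \<open>log 2 (real M)\<close> is positive and priors are nonnegative; so convexity passes from
    the pairwise error probabilities to their weighted sum.\<close>
  proof (intro convex_on_sum_fun S convex_on_cmul)
    fix i j assume i: "i \<in> {1..M}" and j: "j \<in> {1..M} - {i}"
    show "0 \<le> real (hamming_distance (b i) (b j)) / log 2 (real M) * p i"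
      using assms(1) prior_nonneg i by simp
    show "convex_on ?S (\<lambda>v. pairwise_error_prob M s v i j)"
      by (rule convex_on_pairwise_error_prob[OF assms(1) i _ _ S]) (use j in auto)
  qed
qed

end
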